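(* Let $H$ be a Hilbert space and let $A: H\to H$ be a bounded linear operator. Then $A$ is Fredholm if and only if $A=B+F$ for some isomorphism $B$ of $H$ and some operator $F$ on $H$ of finite rank.
   Context: $H$ is a Hilbert space. For a bounded linear operator $A$ on $H$, $A^*$ denotes its adjoint, $N(A)$ its null-space and $R(A)$ its range. An isomorphism is a bounded linear operator $B$ on $H$ that is a bicontinuous injection of $H$ onto $H$, i.e. $B^{-1}$ is defined on all of $H$ and is bounded. A finite-rank operator is a (bounded linear) operator $F$ on $H$ with $\dim R(F)<\infty$. A bounded linear operator $A$ on $H$ is called Fredholm if and only if $\dim N(A)=\dim N(A^* )<\infty$ and both $R(A)$ and $R(A^* )$ are closed subspaces of $H$. (Note that equality of the two dimensions is part of the definition.) *)

theory Defs
  imports "HOL-Analysis.Analysis"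
begin

(* The scalar fields of Hilbert spaces, treated uniformly: the norm is multiplicative and
   sconj x + x = |1 + x|^2 - 1 - |x|^2 is real, so every element is a root of a real polynomial
   of degree 2. Up to isomorphism the only such fields are the real numbers (sconj = id) and
   the complex numbers (sconj = cnj). *)
class hilbert_scalar = real_normed_field +
  fixes sconj :: "'a \<Rightarrow> 'a"
  assumes sconj_add: "sconj (x + y) = sconj x + sconj y"
    and sconj_mult: "sconj (x * y) = sconj x * sconj y"
    and mult_sconj: "x * sconj x = scaleR ((norm x)\<^sup>2) 1"

instantiation real :: hilbert_scalar
begin
definition sconj_real :: "real \<Rightarrow> real" where "sconj_real x = x"
instance by standard (simp_all add: sconj_real_def power2_eq_square)
end

instantiation complex :: hilbert_scalar
begin
definition sconj_complex :: "complex \<Rightarrow> complex" where "sconj_complex = cnj"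
instance
proof
  fix x y :: complex
  show "x * sconj x = scaleR ((norm x)\<^sup>2) 1"
    unfolding sconj_complex_def scaleR_conv_of_real mult_1_right
    by (rule complex_norm_square [symmetric])
qed (simp_all add: sconj_complex_def)
end

(* The norm and topology are those of the Banach space type 'v; the last axiom makes the norm the
   one induced by the inner product, which is linear in its first argument. *)
locale hilbert_space = vector_space scale
  for scale :: "'k::hilbert_scalar \<Rightarrow> 'v::banach \<Rightarrow> 'v" +
  fixes inner :: "'v \<Rightarrow> 'v \<Rightarrow> 'k"
  assumes scale_of_real: "scale (of_real r) x = r *\<^sub>R x"
    and inner_add: "inner (x + y) z = inner x z + inner y z"
    and inner_scale: "inner (scale c x) y = c * inner x y"
    and inner_sconj: "inner y x = sconj (inner x y)"
    and inner_self: "inner x x = of_real ((norm x)\<^sup>2)"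
begin

(* bounded_linear alone only provides linearity over the reals. *)
definition bounded_op :: "('v \<Rightarrow> 'v) \<Rightarrow> bool" where
  "bounded_op A \<longleftrightarrow> bounded_linear A \<and> (\<forall>c x. A (scale c x) = scale c (A x))"

definition adj :: "('v \<Rightarrow> 'v) \<Rightarrow> 'v \<Rightarrow> 'v" where
  "adj A = (THE A'. \<forall>x y. inner (A x) y = inner x (A' y))"

definition null_space :: "('v \<Rightarrow> 'v) \<Rightarrow> 'v set" where
  "null_space A = {x. A x = 0}"

(* Needed alongside dim, which is 0 on infinite-dimensional sets. *)
definition fin_dim :: "'v set \<Rightarrow> bool" where
  "fin_dim S \<longleftrightarrow> (\<exists>b. finite b \<and> S \<subseteq> span b)"

definition isomorphism :: "('v \<Rightarrow> 'v) \<Rightarrow> bool" where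
  "isomorphism B \<longleftrightarrow> bounded_op B \<and> bij B \<and> bounded_op (inv B)"

definition finite_rank :: "('v \<Rightarrow> 'v) \<Rightarrow> bool" where
  "finite_rank F \<longleftrightarrow> bounded_op F \<and> fin_dim (range F)"

definition fredholm :: "('v \<Rightarrow> 'v) \<Rightarrow> bool" where
  "fredholm A \<longleftrightarrow> bounded_op A \<and>
     fin_dim (null_space A) \<and> fin_dim (null_space (adj A)) \<and>
     dim (null_space A) = dim (null_space (adj A)) \<and>
     closed (range A) \<and> closed (range (adj A))"

end

lemma hilbert_space_real:
  "hilbert_space (scaleR :: real \<Rightarrow> 'v \<Rightarrow> 'v::{real_inner, banach}) (\<bullet>)"
proof (unfold_locales, goal_cases)
  case (4 y x)
  show ?case by (simp add: sconj_real_def inner_commute)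
next
  case (5 x)
  show ?case by (simp add: power2_norm_eq_inner)
qed (simp_all add: scaleR_add_right scaleR_add_left inner_add_left)

lemma hilbert_space_complex: "hilbert_space (*) (\<lambda>x y :: complex. x * cnj y)"
proof (unfold_locales, goal_cases)
  case (4 y x)
  show ?case by (simp add: sconj_complex_def)
next
  case (5 x)
  show ?case by (rule complex_norm_square [symmetric])
qed (simp_all add: distrib_left distrib_right scaleR_conv_of_real)

end

theory Submission
  imports Defs
begin

text \<open>
  Take orthonormal bases \<open>e\<close> of \<open>N(A)\<close> and \<open>g\<close> of \<open>N(A\<^sup>*)\<close> with \<open>e\<close> not larger than \<open>g\<close>, an
  injection \<open>f\<close> from \<open>e\<close> to \<open>g\<close>, and the finite-rank operator
  \<open>T x = (\<Sum>u\<in>e. \<langle>x, u\<rangle> f u)\<close>. Since \<open>N(A\<^sup>*)\<close> is orthogonal to \<open>R(A)\<close>, the operator \<open>A + T\<close> is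
  injective. If \<open>A\<close> is Fredholm, then \<open>f\<close> can be chosen bijective, \<open>A + T\<close> is also onto, and its
  inverse is bounded by the open mapping argument; so \<open>A = (A + T) - T\<close>.
  Conversely, if \<open>A\<close> is an isomorphism plus a finite-rank operator, then so is \<open>A + T\<close>, and
  being injective it is onto. This forces \<open>f\<close> to be onto \<open>g\<close> and \<open>R(A)\<close> to be the orthogonal
  complement of \<open>N(A\<^sup>*)\<close>. As \<open>A\<^sup>*\<close> has the same form, the roles of \<open>A\<close> and \<open>A\<^sup>*\<close> may be
  exchanged, so no case is lost by assuming that \<open>e\<close> is not larger than \<open>g\<close>.
\<close>

section \<open>The bounded inverse theorem\<close>

text \<open>By Baire, the closure of the image of some ball has interior points. Differences of two
  points there approximate the images of all small vectors, and rescaling reaches every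
  \<open>y\<close>.\<close>

lemma surj_bounded_linear_approx_preimage:
  fixes f :: "'a::real_normed_vector \<Rightarrow> 'b::banach"
  assumes f: "bounded_linear f" and "surj f"
  obtains M where "0 \<le> M"
    and "\<And>y. \<exists>x. norm x \<le> M * norm y \<and> norm (y - f x) \<le> norm y / 2"
proof -
  interpret f: bounded_linear f by (rule f)
  define C where "C = (\<lambda>n::nat. closure (f ` cball 0 (real n)))"
  have cov: "\<Union>(range C) = UNIV"
  proof (intro set_eqI iffI UNIV_I)
    fix y
    obtain x where x: "f x = y" using \<open>surj f\<close> by (metis surjD)
    obtain n where "norm x \<le> real n" using real_arch_simple by blast
    then have "y \<in> f ` cball 0 (real n)" using x by auto
    then have "y \<in> C n" unfolding C_def by (rule subsetD[OF closure_subset])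
    then show "y \<in> \<Union>(range C)" by blast
  qed
  have closed_C: "closed (C n)" for n unfolding C_def by (rule closed_closure)
  have "\<exists>n. interior (C n) \<noteq> {}"
  proof (rule ccontr)
    assume "\<not> ?thesis"
    then have "(euclidean::'b topology) interior_of \<Union>(range C) = {}"
      using closed_C by (intro Baire_category_alt) (auto simp: completely_metrizable_space_euclidean)
    then show False using cov by simp
  qed
  then obtain n z where "z \<in> interior (C n)" by blast
  then obtain e where e: "e > 0" "ball z e \<subseteq> C n"
    using mem_interior by blast
  have "\<exists>x. norm x \<le> (4 * n / e) * norm y \<and> norm (y - f x) \<le> norm y / 2" for y
  proof (cases "y = 0")
    case True
    then show ?thesis by (intro exI[of _ 0]) (simp add: f.zero)
  next
    case False
    \<comment> \<open>Scaled to norm \<open>e / 2\<close>, \<open>y'\<close> keeps both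
      \<open>z\<close> and \<open>z + y'\<close> inside \<open>ball z e\<close>. Two errors below
      \<open>e / 8\<close> add up to at most \<open>e / 4\<close>, half the norm of
      \<open>y'\<close>, and this ratio survives scaling back by \<open>t\<close>.\<close>
    define y' where "y' = (e / (2 * norm y)) *\<^sub>R y"
    have ny': "norm y' = e / 2" using e False by (simp add: y'_def)
    have "z + y' \<in> C n" "z \<in> C n" using e ny' by (auto simp: dist_norm subset_iff)
    moreover have "\<exists>a. norm a \<le> n \<and> dist (f a) w < e / 8" if "w \<in> C n" for w
      using that e(1) unfolding C_def closure_approachable by (auto dest!: spec[of _ "e / 8"])
    ultimately obtain a b where a: "norm a \<le> n" "dist (f a) (z + y') < e / 8"
      and b: "norm b \<le> n" "dist (f b) z < e / 8"
      by blast
    define t where "t = 2 * norm y / e"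
    have t: "t > 0" using e False by (simp add: t_def)
    have "y' - f (a - b) = (f b - z) - (f a - (z + y'))" by (simp add: f.diff)
    then have "norm (y' - f (a - b)) \<le> norm (f b - z) + norm (f a - (z + y'))"
      by (metis norm_triangle_ineq4)
    also have "\<dots> \<le> e / 4" using a b by (simp add: dist_norm)
    finally have n1: "norm (y' - f (a - b)) \<le> e / 4" .
    have "t *\<^sub>R y' = y" using e False by (simp add: y'_def t_def)
    then have "y - f (t *\<^sub>R (a - b)) = t *\<^sub>R (y' - f (a - b))"
      by (metis f.scaleR scaleR_diff_right)
    then have "norm (y - f (t *\<^sub>R (a - b))) \<le> t * (e / 4)"
      using t n1 by simp
    also have "\<dots> = norm y / 2" using e by (simp add: t_def)
    finally have 1: "norm (y - f (t *\<^sub>R (a - b))) \<le> norm y / 2" .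
    have "norm (a - b) \<le> 2 * n" using a b norm_triangle_ineq4[of a b] by linarith
    then have "norm (t *\<^sub>R (a - b)) \<le> t * (2 * n)" using t by simp
    also have "\<dots> = (4 * n / e) * norm y" by (simp add: t_def)
    finally show ?thesis using 1 by blast
  qed
  then show ?thesis using e by (intro that[of "4 * n / e"]) auto
qed

text \<open>Successive approximation: each approximate preimage halves the residual, so the
  corrections form a geometrically dominated series. Completeness of the domain gives its sum, which
  is the exact preimage and has norm at most \<open>2 * M * norm y\<close>.\<close>

theorem bounded_linear_inv:
  fixes f :: "'a::banach \<Rightarrow> 'b::banach"
  assumes f: "bounded_linear f" and "bij f"
  shows "bounded_linear (inv f)"
proof -
  interpret f: bounded_linear f by (rule f)
  have inj: "inj f" and surj: "surj f" using \<open>bij f\<close> by (auto simp: bij_def)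
  have fi [simp]: "f (inv f y) = y" for y using surj by (simp add: surj_f_inv_f)
  obtain M where "0 \<le> M"
    and M: "\<And>y. \<exists>x. norm x \<le> M * norm y \<and> norm (y - f x) \<le> norm y / 2"
    using surj_bounded_linear_approx_preimage[OF f surj] by blast
  then obtain g where g: "\<And>y. norm (g y) \<le> M * norm y" "\<And>y. norm (y - f (g y)) \<le> norm y / 2"
    by metis
  have bound: "norm (inv f y) \<le> norm y * (2 * M)" for y
  proof -
    \<comment> \<open>\<open>r k\<close> is what remains of \<open>y\<close> after \<open>k\<close>
      corrections; the images of the corrections telescope to \<open>y\<close>.\<close>
    define r where "r = rec_nat y (\<lambda>_ s. s - f (g s))"
    have r0: "r 0 = y" and rS: "r (Suc k) = r k - f (g (r k))" for k by (simp_all add: r_def)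
    have nr: "norm (r k) \<le> norm y * (1 / 2) ^ k" for k
    proof (induction k)
      case (Suc k)
      then show ?case using g(2)[of "r k"] by (simp add: rS)
    qed (simp add: r0)
    have ng: "norm (g (r k)) \<le> M * norm y * (1 / 2) ^ k" for k
      using order_trans[OF g(1) mult_left_mono[OF nr \<open>0 \<le> M\<close>]] by (simp add: mult.assoc)
    have sg: "(\<lambda>k. M * norm y * (1 / 2) ^ k) sums (M * norm y * 2)"
      using sums_mult[OF geometric_sums[of "1 / 2 :: real"], of "M * norm y"] by simp
    have s: "summable (\<lambda>k. g (r k))"
      by (rule summable_comparison_test[OF _ sums_summable[OF sg]]) (use ng in blast)
    have r_lim: "r \<longlonglongrightarrow> 0"
    proof (rule Lim_null_comparison)
      show "(\<lambda>k. norm y * (1 / 2) ^ k) \<longlonglongrightarrow> 0"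
        by (intro tendsto_mult_right_zero LIMSEQ_power_zero) simp
    qed (use nr in auto)
    have "(\<lambda>k. r k - r (Suc k)) sums (r 0 - 0)"
      by (rule telescope_sums'[OF r_lim])
    then have "(\<lambda>k. f (g (r k))) sums y" by (simp add: rS r0)
    moreover have "(\<lambda>k. f (g (r k))) sums f (\<Sum>k. g (r k))"
      using f.sums[OF summable_sums[OF s]] .
    ultimately have "f (\<Sum>k. g (r k)) = y" using sums_unique2 by blast
    then have "inv f y = (\<Sum>k. g (r k))" using inj by (metis inv_f_f)
    also have "norm \<dots> \<le> (\<Sum>k. M * norm y * (1 / 2) ^ k)"
      by (rule norm_suminf_le[OF ng sums_summable[OF sg]])
    also have "\<dots> = norm y * (2 * M)" using sums_unique[OF sg] by (simp only: mult_ac)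
    finally show ?thesis .
  qed
  show ?thesis
  proof (rule bounded_linear_intro[OF _ _ bound])
    show "inv f (x + y) = inv f x + inv f y" for x y
      by (rule injD[OF inj]) (simp add: f.add)
    show "inv f (c *\<^sub>R x) = c *\<^sub>R inv f x" for c x
      by (rule injD[OF inj]) (simp add: f.scaleR)
  qed
qed

section \<open>Inner products and orthogonality\<close>

lemma sconj_zero [simp]: "sconj 0 = (0 :: 'k::hilbert_scalar)"
  using sconj_add[of "0 :: 'k" 0] by simp

text \<open>Like the next two facts, this follows by cancelling a nonzero factor in
  \<open>mult_sconj\<close>; zero is treated apart.\<close>

lemma sconj_of_real [simp]: "sconj (of_real r :: 'k::hilbert_scalar) = of_real r"
proof (cases "r = 0")
  case False
  have "of_real r * sconj (of_real r :: 'k) = of_real r * of_real r"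
    by (simp add: mult_sconj scaleR_conv_of_real flip: power2_eq_square)
  then show ?thesis using False by simp
qed simp

lemma norm_sconj [simp]: "norm (sconj x) = norm (x :: 'k::hilbert_scalar)"
proof (cases "x = 0")
  case False
  have "norm x * norm (sconj x) = norm x * norm x"
    using arg_cong[OF mult_sconj[of x], of norm] by (simp add: norm_mult power2_eq_square)
  then show ?thesis using False by simp
qed simp

lemma sconj_sconj [simp]: "sconj (sconj x) = (x :: 'k::hilbert_scalar)"
proof (cases "x = 0")
  case False
  then have "sconj x \<noteq> 0" by (metis norm_sconj norm_eq_zero)
  moreover have "sconj x * sconj (sconj x) = sconj x * x"
    using mult_sconj[of "sconj x"] mult_sconj[of x] by (simp add: mult.commute)
  ultimately show ?thesis by simp
qed simp

context hilbert_space
begin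

lemma scaleR_eq: "r *\<^sub>R x = scale (of_real r) x"
  by (simp add: scale_of_real)

lemma inner_add_right: "inner x (y + z) = inner x y + inner x z"
  by (metis inner_add inner_sconj sconj_add)

lemma inner_scale_right: "inner x (scale c y) = sconj c * inner x y"
  by (metis inner_scale inner_sconj sconj_mult)

lemma inner_zero [simp]: "inner 0 x = 0" "inner x 0 = 0"
  using inner_add[of 0 0 x] inner_add_right[of x 0 0] by simp_all

lemma inner_minus [simp]: "inner (- x) y = - inner x y" "inner x (- y) = - inner x y"
proof -
  show "inner (- x) y = - inner x y"
    using inner_add[of x "- x" y] by (simp add: eq_neg_iff_add_eq_0 add.commute)
  show "inner x (- y) = - inner x y"
    using inner_add_right[of x y "- y"] by (simp add: eq_neg_iff_add_eq_0 add.commute)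
qed

lemma inner_diff: "inner (x - y) z = inner x z - inner y z"
  using inner_add[of x "- y" z] by simp

lemma inner_diff_right: "inner x (y - z) = inner x y - inner x z"
  using inner_add_right[of x y "- z"] by simp

lemma inner_sum: "inner (\<Sum>i\<in>I. f i) y = (\<Sum>i\<in>I. inner (f i) y)"
  by (induction I rule: infinite_finite_induct) (auto simp: inner_add)

lemma inner_eq_0_iff [simp]: "inner x x = 0 \<longleftrightarrow> x = 0"
  by (simp add: inner_self)

lemma inner_commute_0: "inner x y = 0 \<longleftrightarrow> inner y x = 0"
  by (metis inner_sconj sconj_of_real of_real_0)

text \<open>The choice \<open>z = x - y\<close> decides it. Identities between adjoints are proved
  this way.\<close>

lemma inner_ext: "(\<And>z. inner z x = inner z y) \<Longrightarrow> x = y"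
  by (metis inner_diff_right inner_eq_0_iff right_minus_eq)

text \<open>The Banach space type relates the norm to real scalars only; for general scalars the
  link goes through \<open>inner_self\<close> and \<open>mult_sconj\<close>.\<close>

lemma norm_scale [simp]: "norm (scale c x) = norm c * norm x"
proof -
  have "of_real ((norm (scale c x))\<^sup>2) = c * sconj c * (inner x x :: 'k)"
    by (simp only: inner_self[symmetric] inner_scale inner_scale_right mult_ac)
  also have "\<dots> = of_real ((norm c * norm x)\<^sup>2)"
    by (simp add: mult_sconj inner_self scaleR_conv_of_real power_mult_distrib)
  finally have "(norm (scale c x))\<^sup>2 = (norm c * norm x)\<^sup>2"
    unfolding of_real_eq_iff .
  then show ?thesis by (simp add: power2_eq_iff_nonneg)
qed

lemma pythagoras:
  assumes "inner x y = 0"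
  shows "(norm (x + y))\<^sup>2 = (norm x)\<^sup>2 + (norm y)\<^sup>2"
proof -
  have "inner y x = 0" using assms inner_commute_0 by blast
  then have "inner (x + y) (x + y) = inner x x + inner y y"
    using assms by (simp add: inner_add inner_add_right)
  then show ?thesis unfolding inner_self by (metis of_real_add of_real_eq_iff)
qed

lemma parallelogram:
  fixes x y :: 'v
  shows "(norm (x + y))\<^sup>2 + (norm (x - y))\<^sup>2 = 2 * (norm x)\<^sup>2 + 2 * (norm y)\<^sup>2"
proof -
  have "inner (x + y) (x + y) + inner (x - y) (x - y) = 2 * inner x x + 2 * inner y y"
    by (simp add: inner_add inner_add_right inner_diff inner_diff_right)
  then have "(of_real ((norm (x + y))\<^sup>2 + (norm (x - y))\<^sup>2) :: 'k)
      = of_real (2 * (norm x)\<^sup>2 + 2 * (norm y)\<^sup>2)"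
    by (simp add: inner_self)
  then show ?thesis unfolding of_real_eq_iff .
qed

text \<open>Pythagoras for the projection onto the line through \<open>y\<close>. It yields both
  Cauchy-Schwarz and the orthogonality of a nearest point.\<close>

lemma norm_diff_component:
  fixes x y :: 'v
  assumes "y \<noteq> 0"
  defines "c \<equiv> inner x y / inner y y"
  shows "(norm (x - scale c y))\<^sup>2 = (norm x)\<^sup>2 - (norm c * norm y)\<^sup>2"
proof -
  have "inner (x - scale c y) (scale c y) = 0"
    using assms by (simp add: inner_diff inner_scale inner_scale_right)
  from pythagoras[OF this] show ?thesis by simp
qed

lemma Cauchy_Schwarz: "norm (inner x y) \<le> norm x * norm y"
proof (cases "y = 0")
  case False
  define c where "c = inner x y / inner y y"
  have "(norm c * norm y)\<^sup>2 \<le> (norm x)\<^sup>2"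
    using norm_diff_component[OF False, of x] zero_le_power2[of "norm (x - scale c y)"]
    unfolding c_def by linarith
  then have "norm c * norm y \<le> norm x" by (rule power2_le_imp_le) simp
  moreover have "norm c * norm y = norm (inner x y) / norm y"
    using False by (simp add: c_def inner_self norm_divide norm_mult power2_eq_square)
  ultimately show ?thesis using False by (simp add: divide_simps)
qed simp

lemma bounded_linear_inner: "bounded_linear (\<lambda>x. inner x y)"
  by (rule bounded_linear_intro[where K = "norm y"])
    (simp_all add: inner_add scaleR_eq inner_scale scaleR_conv_of_real Cauchy_Schwarz)

section \<open>Orthogonal complements and the projection theorem\<close>

definition perp :: "'v set \<Rightarrow> 'v set" where
  "perp S = {x. \<forall>y\<in>S. inner x y = 0}"

lemma closed_perp: "closed (perp S)"
proof -
  have "perp S = (\<Inter>y\<in>S. {x. inner x y = 0})" by (auto simp: perp_def)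
  also have "closed \<dots>"
    by (intro closed_INT ballI closed_Collect_eq continuous_on_const
        linear_continuous_on bounded_linear_inner)
  finally show ?thesis .
qed

lemma inner_span_eq_0:
  assumes "\<And>v. v \<in> S \<Longrightarrow> inner x v = 0" and "y \<in> span S"
  shows "inner x y = 0"
  using assms(2)
  by (induction rule: span_induct_alt) (simp_all add: inner_add_right inner_scale_right assms(1))

text \<open>A sequence in \<open>M\<close> minimizing the distance to \<open>x\<close> is Cauchy by
  the parallelogram law; its limit is a nearest point, and the error at a nearest point is
  orthogonal to \<open>M\<close>.\<close>

theorem orthogonal_projection:
  assumes M: "subspace M" "closed M"
  shows "\<exists>m\<in>M. \<forall>y\<in>M. inner (x - m) y = 0"
proof -
  define D where "D = (INF m\<in>M. (norm (x - m))\<^sup>2)"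
  have ne: "M \<noteq> {}" using subspace_0[OF M(1)] by blast
  have bdd: "bdd_below ((\<lambda>m. (norm (x - m))\<^sup>2) ` M)" by (rule bdd_belowI[of _ 0]) auto
  have D_le: "D \<le> (norm (x - m))\<^sup>2" if "m \<in> M" for m
    unfolding D_def by (rule cINF_lower[OF bdd that])
  have "\<exists>m\<in>M. (norm (x - m))\<^sup>2 < D + inverse (real (Suc k))" for k
    using cINF_less_iff[OF ne bdd, of "D + inverse (real (Suc k))"] by (simp add: D_def)
  then obtain m where m: "\<And>k. m k \<in> M" "\<And>k. (norm (x - m k))\<^sup>2 < D + inverse (real (Suc k))"
    by metis
  have close: "(norm (m i - m j))\<^sup>2 < 2 * inverse (real (Suc i)) + 2 * inverse (real (Suc j))" for i j
  proof -
    \<comment> \<open>The midpoint stays in \<open>M\<close>, so its squared distance to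
      \<open>x\<close> is at least \<open>D\<close>; the parallelogram law then leaves little room
      for \<open>m i - m j\<close>.\<close>
    define h where "h = (1/2) *\<^sub>R (m i + m j)"
    have "h \<in> M"
      unfolding h_def scaleR_eq by (intro subspace_scale subspace_add M m)
    have e1: "(x - m i) + (x - m j) = 2 *\<^sub>R (x - h)"
      by (simp add: h_def algebra_simps scaleR_2)
    have e2: "norm ((x - m i) - (x - m j)) = norm (m i - m j)"
      by (simp add: norm_minus_commute)
    have "4 * (norm (x - h))\<^sup>2 + (norm (m i - m j))\<^sup>2
        = 2 * (norm (x - m i))\<^sup>2 + 2 * (norm (x - m j))\<^sup>2"
      using parallelogram[of "x - m i" "x - m j"] unfolding e1 e2 by (simp add: power_mult_distrib)
    then show ?thesis using D_le[OF \<open>h \<in> M\<close>] m(2)[of i] m(2)[of j] by linarith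
  qed
  have "Cauchy m"
  proof (rule CauchyI)
    fix e :: real assume "0 < e"
    then obtain N where N: "inverse (real (Suc N)) < e\<^sup>2 / 4"
      using reals_Archimedean[of "e\<^sup>2 / 4"] by auto
    have small: "inverse (real (Suc i)) \<le> inverse (real (Suc N))" if "i \<ge> N" for i
      using that by (simp add: divide_simps)
    show "\<exists>N. \<forall>i\<ge>N. \<forall>j\<ge>N. norm (m i - m j) < e"
    proof (intro exI[of _ N] allI impI)
      fix i j assume "i \<ge> N" "j \<ge> N"
      then have "(norm (m i - m j))\<^sup>2 < e\<^sup>2"
        using close[of i j] small[of i] small[of j] N by linarith
      then show "norm (m i - m j) < e"
        using \<open>0 < e\<close> by (simp add: power_less_imp_less_base)
    qed
  qed
  then obtain l where l: "m \<longlonglongrightarrow> l" using Cauchy_convergent_iff convergent_def by blast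
  have "l \<in> M" using closed_sequentially[OF M(2) _ l] m(1) by blast
  have "(norm (x - l))\<^sup>2 \<le> D + 0"
  proof (rule LIMSEQ_le)
    show "(\<lambda>k. (norm (x - m k))\<^sup>2) \<longlonglongrightarrow> (norm (x - l))\<^sup>2" by (intro tendsto_intros l)
    show "(\<lambda>k. D + inverse (real (Suc k))) \<longlonglongrightarrow> D + 0"
      by (intro tendsto_add tendsto_const LIMSEQ_inverse_real_of_nat)
  qed (use m(2) less_imp_le in blast)
  then have min: "(norm (x - l))\<^sup>2 \<le> (norm (x - y))\<^sup>2" if "y \<in> M" for y
    using D_le[OF that] by linarith
  have "inner (x - l) y = 0" if "y \<in> M" for y
  proof (cases "y = 0")
    case False
    \<comment> \<open>Moving from \<open>l\<close> to \<open>l + scale c y\<close> stays in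
      \<open>M\<close> and lowers the squared distance by \<open>(norm c * norm y)\<^sup>2\<close>,
      so minimality forces \<open>c = 0\<close>.\<close>
    define c where "c = inner (x - l) y / inner y y"
    have "l + scale c y \<in> M" using \<open>l \<in> M\<close> that M by (simp add: subspace_add subspace_scale)
    from min[OF this] have "(norm c * norm y)\<^sup>2 \<le> 0"
      using norm_diff_component[OF False, of "x - l"] unfolding c_def diff_diff_eq by linarith
    then have "c = 0" using False by simp
    then show ?thesis using False by (simp add: c_def)
  qed simp
  then show ?thesis using \<open>l \<in> M\<close> by blast
qed

section \<open>Bounded operators and adjoints\<close>

lemma bounded_op_linear:
  assumes "bounded_op A"
  shows "A 0 = 0" "A (x + y) = A x + A y" "A (x - y) = A x - A y" "A (scale c x) = scale c (A x)"
    "A (- x) = - A x"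
proof -
  interpret bounded_linear A using assms by (simp add: bounded_op_def)
  show "A 0 = 0" "A (x + y) = A x + A y" "A (x - y) = A x - A y" "A (- x) = - A x"
    by (rule zero add diff neg)+
  show "A (scale c x) = scale c (A x)" using assms by (simp add: bounded_op_def)
qed

lemma bounded_op_module_hom:
  assumes "bounded_op A"
  shows "module_hom scale scale A"
  by unfold_locales (simp_all add: bounded_op_linear[OF assms] scale_right_distrib scale_left_distrib)

lemma bounded_opI:
  assumes "\<And>x y. A (x + y) = A x + A y" "\<And>c x. A (scale c x) = scale c (A x)"
    and "\<And>x. norm (A x) \<le> norm x * K"
  shows "bounded_op A"
  unfolding bounded_op_def
  using bounded_linear_intro[of A K] assms by (simp add: scaleR_eq)

lemma bounded_op_zero: "bounded_op (\<lambda>x. 0)"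
  by (rule bounded_opI[where K = 0]) auto

lemma bounded_op_add: "bounded_op A \<Longrightarrow> bounded_op B \<Longrightarrow> bounded_op (\<lambda>x. A x + B x)"
  unfolding bounded_op_def by (simp add: bounded_linear_add scale_right_distrib)

lemma bounded_op_minus: "bounded_op A \<Longrightarrow> bounded_op (\<lambda>x. - A x)"
  unfolding bounded_op_def by (simp add: bounded_linear_minus)

lemma bounded_op_compose: "bounded_op A \<Longrightarrow> bounded_op B \<Longrightarrow> bounded_op (\<lambda>x. A (B x))"
  unfolding bounded_op_def by (simp add: bounded_linear_compose)

lemma bounded_op_rank_one: "bounded_op (\<lambda>x. scale (inner x u) v)"
  by (rule bounded_opI[where K = "norm u * norm v"])
    (simp_all add: inner_add inner_scale scale_left_distrib mult_right_mono[OF Cauchy_Schwarz]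
      flip: mult.assoc)

text \<open>Boundedness of the inverse comes from the bounded inverse theorem; what remains is its
  homogeneity over the scalar field.\<close>

lemma isomorphismI:
  assumes "bounded_op A" "bij A"
  shows "isomorphism A"
proof -
  have s: "A (inv A y) = y" for y using assms(2) by (simp add: bij_is_surj surj_f_inv_f)
  have "bounded_linear (inv A)" using assms bounded_linear_inv by (auto simp: bounded_op_def)
  moreover have "inv A (scale c x) = scale c (inv A x)" for c x
    by (rule injD[OF bij_is_inj[OF assms(2)]]) (simp add: s bounded_op_linear(4)[OF assms(1)])
  ultimately show ?thesis using assms by (simp add: isomorphism_def bounded_op_def)
qed

section \<open>Riesz representation and adjoints\<close>

theorem Riesz_representation:
  assumes f: "bounded_linear f" and fs: "\<And>c x. f (scale c x) = c * f x"
  obtains y where "\<And>x. f x = inner x y"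
proof (cases "\<forall>x. f x = 0")
  case True
  then show ?thesis using that[of 0] by simp
next
  case False
  interpret bounded_linear f by (rule f)
  obtain x0 where x0: "f x0 \<noteq> 0" using False by blast
  have "subspace {x. f x = 0}" by (simp add: subspace_def fs add zero)
  moreover have "closed {x. f x = 0}"
    by (intro closed_Collect_eq linear_continuous_on f continuous_on_const)
  ultimately have "\<exists>m\<in>{x. f x = 0}. \<forall>y\<in>{x. f x = 0}. inner (x0 - m) y = 0"
    by (rule orthogonal_projection)
  then obtain m where m: "f m = 0" "\<And>y. f y = 0 \<Longrightarrow> inner (x0 - m) y = 0" by auto
  \<comment> \<open>\<open>z\<close> is the component of \<open>x0\<close> orthogonal to the kernel
    of \<open>f\<close>, and it is nonzero because \<open>f x0\<close> is.\<close>
  define z where "z = x0 - m"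
  have fz: "f z \<noteq> 0" using x0 m by (simp add: z_def diff)
  then have zz: "inner z z \<noteq> 0" by (metis inner_eq_0_iff zero)
  have "f x = inner x (scale (sconj (f z / inner z z)) z)" for x
  proof -
    \<comment> \<open>This combination of \<open>x\<close> and \<open>z\<close> lies in the kernel,
      hence is orthogonal to \<open>z\<close>; solving for \<open>f x\<close> gives the
      representation.\<close>
    have "f (scale (f z) x - scale (f x) z) = 0" by (simp add: diff fs)
    then have "inner z (scale (f z) x - scale (f x) z) = 0" using m(2) unfolding z_def by blast
    then have "inner (scale (f z) x - scale (f x) z) z = 0" using inner_commute_0 by blast
    then have "f z * inner x z = f x * inner z z" by (simp add: inner_diff inner_scale)
    then show ?thesis using zz by (simp add: inner_scale_right field_simps)
  qed
  then show ?thesis using that by blast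
qed

text \<open>\<open>adj\<close> is a definite description; uniqueness from \<open>inner_ext\<close>
  lets any candidate with the defining identity be recognized as the adjoint.\<close>

lemma adj_eqI:
  assumes "\<And>x y. inner (A x) y = inner x (A' y)"
  shows "adj A = A'"
  unfolding adj_def
proof (rule the_equality)
  fix C assume "\<forall>x y. inner (A x) y = inner x (C y)"
  then show "C = A'" using assms by (intro ext inner_ext) metis
qed (use assms in blast)

lemma inner_adj:
  assumes A: "bounded_op A"
  shows "inner (A x) y = inner x (adj A y)"
proof -
  have "\<exists>z. \<forall>x. inner (A x) y = inner x z" for y
  proof -
    have "bounded_linear (\<lambda>x. inner (A x) y)"
      using bounded_linear_compose[OF bounded_linear_inner] A by (auto simp: bounded_op_def)
    then show ?thesis
      using Riesz_representation[of "\<lambda>x. inner (A x) y"]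
      by (metis A bounded_op_linear(4) inner_scale)
  qed
  then obtain A' where A': "\<And>x y. inner (A x) y = inner x (A' y)" by metis
  then show ?thesis using adj_eqI[OF A'] by simp
qed

lemma inner_adj_left: "bounded_op A \<Longrightarrow> inner (adj A x) y = inner x (A y)"
  by (metis inner_adj inner_sconj)

lemma bounded_op_adj:
  assumes A: "bounded_op A"
  shows "bounded_op (adj A)"
proof -
  obtain K where K: "K \<ge> 0" "\<And>x. norm (A x) \<le> norm x * K"
    using A bounded_linear.nonneg_bounded unfolding bounded_op_def by blast
  show ?thesis
  proof (rule bounded_opI[where K = K])
    show "adj A (x + y) = adj A x + adj A y" for x y
      by (rule inner_ext) (simp add: inner_add_right flip: inner_adj[OF A])
    show "adj A (scale c x) = scale c (adj A x)" for c x
      by (rule inner_ext) (simp add: inner_scale_right flip: inner_adj[OF A])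
    show "norm (adj A y) \<le> norm y * K" for y
    proof (cases "adj A y = 0")
      case False
      let ?z = "adj A y"
      \<comment> \<open>The defining identity is tested at \<open>adj A y\<close> itself, so one
        factor \<open>norm ?z\<close> cancels at the end.\<close>
      have "(norm ?z)\<^sup>2 = norm (inner (A ?z) y)"
        by (simp add: inner_adj[OF A] inner_self norm_power)
      also have "\<dots> \<le> (norm ?z * K) * norm y"
        by (rule order_trans[OF Cauchy_Schwarz]) (simp add: K mult_right_mono)
      finally show ?thesis using False by (simp add: power2_eq_square ac_simps)
    qed (simp add: K)
  qed
qed

lemma adj_adj: "bounded_op A \<Longrightarrow> adj (adj A) = A"
  by (rule adj_eqI) (rule inner_adj_left)

lemma adj_add:
  assumes "bounded_op A" "bounded_op B"
  shows "adj (\<lambda>x. A x + B x) = (\<lambda>x. adj A x + adj B x)"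
  by (rule adj_eqI)
    (simp add: inner_add inner_add_right inner_adj[OF assms(1)] inner_adj[OF assms(2)])

text \<open>The adjoint of \<open>inv B\<close> is a two-sided inverse of
  \<open>adj B\<close>.\<close>

lemma isomorphism_adj:
  assumes "isomorphism B"
  shows "isomorphism (adj B)"
proof (rule isomorphismI)
  have B: "bounded_op B" and G: "bounded_op (inv B)" and bij: "bij B"
    using assms by (auto simp: isomorphism_def)
  have "adj B (adj (inv B) y) = y" for y
    by (rule inner_ext) (simp add: bij bij_is_inj flip: inner_adj[OF B] inner_adj[OF G])
  moreover have "adj (inv B) (adj B y) = y" for y
    by (rule inner_ext) (simp add: bij bij_is_surj surj_f_inv_f flip: inner_adj[OF B] inner_adj[OF G])
  ultimately show "bij (adj B)" by (intro o_bij[of "adj (inv B)"]) auto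
  show "bounded_op (adj B)" by (rule bounded_op_adj[OF B])
qed

lemma subspace_null_space: "bounded_op A \<Longrightarrow> subspace (null_space A)"
  by (simp add: subspace_def null_space_def bounded_op_linear)

lemma subspace_range: "bounded_op A \<Longrightarrow> subspace (range A)"
  using module_hom.subspace_image[OF bounded_op_module_hom subspace_UNIV] .

text \<open>For \<open>y\<close> orthogonal to the range, testing against \<open>A (adj A y)\<close>
  gives \<open>adj A y = 0\<close>.\<close>

lemma null_space_adj:
  assumes "bounded_op A"
  shows "null_space (adj A) = perp (range A)"
proof -
  have "adj A y = 0" if "\<And>x. inner y (A x) = 0" for y
    using that[of "adj A y"] by (simp flip: inner_adj_left[OF assms])
  then show ?thesis
    by (auto simp: null_space_def perp_def simp flip: inner_adj_left[OF assms])
qed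

section \<open>Finite-dimensional subspaces\<close>

lemma fin_dim_subset: "fin_dim T \<Longrightarrow> S \<subseteq> T \<Longrightarrow> fin_dim S"
  unfolding fin_dim_def by blast

lemma fin_dim_image:
  assumes "bounded_op A" "fin_dim S"
  shows "fin_dim (A ` S)"
proof -
  obtain b where b: "finite b" "S \<subseteq> span b" using assms(2) by (auto simp: fin_dim_def)
  have "A ` S \<subseteq> span (A ` b)"
    using b(2) module_hom.span_image[OF bounded_op_module_hom[OF assms(1)], of b] by blast
  then show ?thesis using b(1) by (auto simp: fin_dim_def)
qed

lemma finite_rank_zero: "finite_rank (\<lambda>x. 0)"
  unfolding finite_rank_def fin_dim_def using bounded_op_zero by (auto intro!: exI[of _ "{}"])

lemma finite_rank_add:
  assumes "finite_rank E" "finite_rank F"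
  shows "finite_rank (\<lambda>x. E x + F x)"
proof -
  obtain a b where ab: "finite a" "range E \<subseteq> span a" "finite b" "range F \<subseteq> span b"
    using assms by (auto simp: finite_rank_def fin_dim_def)
  have "E x + F x \<in> span (a \<union> b)" for x
    using ab span_mono[of a "a \<union> b"] span_mono[of b "a \<union> b"] by (intro span_add) auto
  then show ?thesis
    using assms ab bounded_op_add unfolding finite_rank_def fin_dim_def
    by (auto intro!: exI[of _ "a \<union> b"])
qed

lemma finite_rank_minus:
  assumes "finite_rank F"
  shows "finite_rank (\<lambda>x. - F x)"
proof -
  obtain b where "finite b" "range F \<subseteq> span b"
    using assms by (auto simp: finite_rank_def fin_dim_def)
  then show ?thesis
    using assms bounded_op_minus span_neg unfolding finite_rank_def fin_dim_def
    by (auto intro!: exI[of _ b])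
qed

lemma finite_rank_rank_one: "finite_rank (\<lambda>x. scale (inner x u) v)"
  unfolding finite_rank_def fin_dim_def
  by (auto intro!: bounded_op_rank_one exI[of _ "{v}"] span_scale[OF span_base])

lemma finite_rank_sum:
  "finite I \<Longrightarrow> (\<And>i. i \<in> I \<Longrightarrow> finite_rank (F i)) \<Longrightarrow> finite_rank (\<lambda>x. \<Sum>i\<in>I. F i x)"
  by (induction I rule: finite_induct) (auto intro: finite_rank_zero finite_rank_add)

section \<open>Finite orthonormal systems\<close>

definition orthonormal :: "'v set \<Rightarrow> bool" where
  "orthonormal e \<longleftrightarrow> finite e \<and> (\<forall>u\<in>e. \<forall>v\<in>e. inner u v = (if u = v then 1 else 0))"

lemma zero_notin_orthonormal: "orthonormal e \<Longrightarrow> 0 \<notin> e"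
  unfolding orthonormal_def by (metis inner_zero(1) zero_neq_one)

text \<open>For orthonormal \<open>e\<close> this sends each \<open>u\<close> in \<open>e\<close> to
  \<open>f u\<close> and kills the orthogonal complement of \<open>e\<close>. With
  \<open>f = id\<close> it is the orthogonal projection onto \<open>span e\<close>.\<close>

definition transfer :: "'v set \<Rightarrow> ('v \<Rightarrow> 'v) \<Rightarrow> 'v \<Rightarrow> 'v" where
  "transfer e f x = (\<Sum>u\<in>e. scale (inner x u) (f u))"

lemma finite_rank_transfer: "finite e \<Longrightarrow> finite_rank (transfer e f)"
  unfolding transfer_def[abs_def] by (intro finite_rank_sum finite_rank_rank_one)

lemma transfer_in_span: "f ` e \<subseteq> g \<Longrightarrow> transfer e f x \<in> span g"
  unfolding transfer_def by (intro span_sum span_scale span_base) auto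

lemma inner_transfer:
  assumes "orthonormal g" "finite e" "f ` e \<subseteq> g" "inj_on f e" "u \<in> e"
  shows "inner (transfer e f x) (f u) = inner x u"
proof -
  have "inner (transfer e f x) (f u) = (\<Sum>v\<in>e. if v = u then inner x u else 0)"
    unfolding transfer_def inner_sum
  proof (rule sum.cong[OF refl])
    fix v assume "v \<in> e"
    then show "inner (scale (inner x v) (f v)) (f u) = (if v = u then inner x u else 0)"
      using assms by (auto simp: inner_scale orthonormal_def inj_on_eq_iff image_subset_iff)
  qed
  then show ?thesis using assms by simp
qed

lemma inner_transfer_0:
  assumes "orthonormal g" "f ` e \<subseteq> g" "v \<in> g - f ` e"
  shows "inner (transfer e f x) v = 0"
  unfolding transfer_def inner_sum
proof (rule sum.neutral, rule ballI)
  fix u assume "u \<in> e"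
  then have "inner (f u) v = 0" using assms unfolding orthonormal_def by (metis DiffE image_eqI subsetD)
  then show "inner (scale (inner x u) (f u)) v = 0" by (simp add: inner_scale)
qed

lemma orthonormal_residual:
  assumes "orthonormal e" "y \<in> span e"
  shows "inner (x - transfer e id x) y = 0"
proof (rule inner_span_eq_0[OF _ assms(2)])
  fix v assume "v \<in> e"
  then show "inner (x - transfer e id x) v = 0"
    using inner_transfer[of e e id v x] assms(1) by (simp add: inner_diff orthonormal_def)
qed

text \<open>The residual lies in \<open>span e\<close> and is orthogonal to it, hence
  vanishes.\<close>

lemma transfer_id_span:
  assumes "orthonormal e" "x \<in> span e"
  shows "transfer e id x = x"
proof -
  have "x - transfer e id x \<in> span e" using assms by (intro span_diff transfer_in_span) auto
  then have "inner (x - transfer e id x) (x - transfer e id x) = 0"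
    using orthonormal_residual assms by blast
  then show ?thesis by simp
qed

lemma orthonormal_independent:
  assumes "orthonormal e"
  shows "independent e"
proof
  assume "dependent e"
  then obtain v where v: "v \<in> e" "v \<in> span (e - {v})" unfolding dependent_def by blast
  have "inner v v = 0"
    by (rule inner_span_eq_0[OF _ v(2)]) (use v assms in \<open>auto simp: orthonormal_def\<close>)
  then show False using v(1) zero_notin_orthonormal[OF assms] by simp
qed

lemma dim_span_orthonormal: "orthonormal e \<Longrightarrow> dim (span e) = card e"
  by (rule dim_span_eq_card_independent[OF orthonormal_independent])

lemma Gram_Schmidt: "finite b \<Longrightarrow> \<exists>e. orthonormal e \<and> span e = span b"
proof (induction b rule: finite_induct)
  case empty
  show ?case by (intro exI[of _ "{}"]) (simp add: orthonormal_def)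
next
  case (insert v b)
  then obtain e where e: "orthonormal e" "span e = span b" by blast
  \<comment> \<open>\<open>w\<close> is the part of \<open>v\<close> orthogonal to the system built
    so far: if it vanishes, \<open>v\<close> adds nothing to the span; otherwise its normalization
    joins the system.\<close>
  define w where "w = v - transfer e id v"
  have t: "transfer e id v \<in> span e" by (rule transfer_in_span) simp
  show ?case
  proof (cases "w = 0")
    case True
    then have "v \<in> span b" using t e(2) by (simp add: w_def)
    then have "span (insert v b) = span b" by (rule span_redundant)
    then show ?thesis using e by auto
  next
    case False
    define u where "u = scale (of_real (inverse (norm w))) w"
    have nu: "norm u = 1" using False by (simp add: u_def norm_inverse)
    have ue: "inner u y = 0" "inner y u = 0" if "y \<in> e" for y
    proof -
      show "inner u y = 0"
        using orthonormal_residual[OF e(1), of y v] that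
        by (simp add: u_def inner_scale w_def span_base)
      then show "inner y u = 0" using inner_commute_0 by blast
    qed
    have uu: "inner u u = 1" by (simp add: inner_self nu)
    then have "u \<notin> e" using ue(1)[of u] by auto
    then have "orthonormal (insert u e)"
      using e(1) ue uu by (auto simp: orthonormal_def)
    moreover have "span (insert u e) = span (insert v b)"
    proof -
      have veq: "v = scale (of_real (norm w)) u + transfer e id v"
        using False by (simp add: u_def w_def flip: of_real_mult)
      have te: "transfer e id v \<in> span (insert u e)"
        using t span_mono[of e "insert u e"] by blast
      have tb: "transfer e id v \<in> span (insert v b)"
        using t e(2) span_mono[of b "insert v b"] by blast
      have 1: "insert v b \<subseteq> span (insert u e)"
      proof (intro insert_subsetI)
        show "v \<in> span (insert u e)"
          by (subst veq) (intro span_add span_scale te span_base insertI1)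
        show "b \<subseteq> span (insert u e)"
          using span_superset[of b] e(2) span_mono[of e "insert u e"] by blast
      qed
      have 2: "insert u e \<subseteq> span (insert v b)"
      proof (intro insert_subsetI)
        show "u \<in> span (insert v b)"
          unfolding u_def w_def by (intro span_scale span_diff tb span_base insertI1)
        show "e \<subseteq> span (insert v b)"
          using span_superset[of e] e(2) span_mono[of b "insert v b"] by blast
      qed
      show ?thesis using 1 2 by (metis span_eq)
    qed
    ultimately show ?thesis by blast
  qed
qed

text \<open>\<open>fin_dim\<close> allows the finite spanning set to lie outside \<open>S\<close>; a
  basis chosen inside \<open>S\<close> is finite by the exchange bound.\<close>

lemma finite_basis:
  assumes "fin_dim S" "subspace S"
  obtains c where "finite c" "independent c" "span c = S"
proof -
  obtain b where b: "finite b" "S \<subseteq> span b" using assms by (auto simp: fin_dim_def)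
  obtain c where c: "c \<subseteq> S" "independent c" "S \<subseteq> span c" using basis_exists by metis
  have "finite c" using independent_span_bound[OF b(1) c(2)] b c by blast
  moreover have "span c = S" using c span_minimal[OF c(1) assms(2)] by blast
  ultimately show ?thesis using that c by blast
qed

lemma orthonormal_basis:
  assumes "fin_dim S" "subspace S"
  obtains e where "orthonormal e" "span e = S"
  using finite_basis[OF assms] Gram_Schmidt by metis

text \<open>\<open>adj F\<close> kills the orthogonal complement of \<open>range F\<close>, so its
  range is already the image of the finite-dimensional space \<open>range F\<close>.\<close>

lemma finite_rank_adj:
  assumes "finite_rank F"
  shows "finite_rank (adj F)"
proof -
  have F: "bounded_op F" "fin_dim (range F)" using assms by (auto simp: finite_rank_def)
  obtain e where e: "orthonormal e" "span e = range F"
    using orthonormal_basis[OF F(2) subspace_range[OF F(1)]] .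
  have "adj F y \<in> adj F ` range F" for y
  proof -
    have "inner (adj F (y - transfer e id y)) z = 0" for z
      unfolding inner_adj_left[OF F(1)] by (rule orthonormal_residual) (simp_all add: e)
    then have "adj F y = adj F (transfer e id y)"
      using inner_eq_0_iff by (simp add: bounded_op_linear(3)[OF bounded_op_adj[OF F(1)]])
        (metis inner_eq_0_iff right_minus_eq)
    moreover have "transfer e id y \<in> range F"
      using transfer_in_span[of id e e y] e(2) by simp
    ultimately show ?thesis by blast
  qed
  then have "range (adj F) \<subseteq> adj F ` range F" by blast
  then show ?thesis
    using fin_dim_subset[OF fin_dim_image[OF bounded_op_adj[OF F(1)] F(2)]] bounded_op_adj[OF F(1)]
    by (simp add: finite_rank_def)
qed

section \<open>Perturbations of finite rank\<close>

text \<open>An injective map turns a basis of \<open>W\<close> into equally many independent vectors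
  of \<open>W\<close>; a vector outside their span would violate the exchange bound.\<close>

lemma injective_on_invariant_fin_dim:
  assumes S: "bounded_op S" "inj S" and W: "subspace W" "fin_dim W" "S ` W \<subseteq> W"
  shows "S ` W = W"
proof -
  interpret vector_space_pair scale scale by unfold_locales
  have lin: "Vector_Spaces.linear scale scale S"
    using bounded_op_module_hom[OF S(1)] by (simp add: linear_iff_module_hom)
  obtain c where c: "finite c" "independent c" "span c = W" using finite_basis W by metis
  have ind: "independent (S ` c)"
    using linear_independent_injective_image[OF lin c(2)] S(2) inj_on_subset by blast
  have sub: "S ` c \<subseteq> W" using c(3) span_superset W(3) by blast
  have "W \<subseteq> span (S ` c)"
  proof
    fix w assume "w \<in> W"
    show "w \<in> span (S ` c)"
    proof (rule ccontr)
      assume w: "w \<notin> span (S ` c)"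
      have "card (insert w (S ` c)) \<le> card c"
        using independent_span_bound[OF c(1) independent_insertI[OF w ind]] sub \<open>w \<in> W\<close> c(3) by auto
      moreover have "card (S ` c) = card c" using S(2) by (meson card_image inj_on_subset subset_UNIV)
      moreover have "w \<notin> S ` c" using w span_base by blast
      ultimately show False using c(1) by simp
    qed
  qed
  then show ?thesis using W(3) module_hom.span_image[OF bounded_op_module_hom[OF S(1)], of c] c(3)
    by auto
qed

text \<open>\<open>range K\<close> is finite-dimensional and invariant under the identity plus
  \<open>K\<close>, so injectivity gives surjectivity there. A preimage \<open>w\<close> of
  \<open>K y\<close> inside \<open>range K\<close> then corrects \<open>y\<close> to a preimage
  \<open>y - w\<close> of \<open>y\<close>.\<close>

lemma Fredholm_alternative:
  assumes K: "finite_rank K" and inj: "inj (\<lambda>x. x + K x)"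
  shows "surj (\<lambda>x. x + K x)"
proof -
  have K': "bounded_op K" "fin_dim (range K)" using K by (auto simp: finite_rank_def)
  define S where "S = (\<lambda>x. x + K x)"
  have "bounded_op (\<lambda>x. x)" by (simp add: bounded_op_def bounded_linear_ident)
  then have S: "bounded_op S" unfolding S_def by (rule bounded_op_add[OF _ K'(1)])
  have inv: "S ` range K \<subseteq> range K"
    unfolding S_def using subspace_add[OF subspace_range[OF K'(1)]] by blast
  have W: "S ` range K = range K"
    by (rule injective_on_invariant_fin_dim[OF S _ subspace_range[OF K'(1)] K'(2) inv])
      (use inj in \<open>simp add: S_def\<close>)
  have "\<exists>x. y = S x" for y
  proof -
    have "K y \<in> S ` range K" unfolding W by blast
    then obtain w where "S w = K y" by (metis imageE)
    then have "S (y - w) = y" unfolding bounded_op_linear(3)[OF S] by (simp add: S_def)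
    then show ?thesis by metis
  qed
  then show ?thesis unfolding surj_def S_def by blast
qed

text \<open>Composing with \<open>inv B\<close> turns \<open>B + F\<close> into the identity plus
  the finite-rank operator \<open>F (inv B y)\<close>, so the Fredholm alternative applies.\<close>

lemma isomorphism_plus_finite_rank_surj:
  assumes B: "isomorphism B" and F: "finite_rank F" and inj: "inj (\<lambda>x. B x + F x)"
  shows "surj (\<lambda>x. B x + F x)"
proof -
  have bij: "bij B" and G: "bounded_op (inv B)" using B by (auto simp: isomorphism_def)
  have BG: "B (inv B y) = y" for y using bij by (simp add: bij_is_surj surj_f_inv_f)
  have "fin_dim (range (\<lambda>x. F (inv B x)))"
    by (rule fin_dim_subset[of "range F"]) (use F in \<open>auto simp: finite_rank_def\<close>)
  then have "finite_rank (\<lambda>x. F (inv B x))"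
    using F bounded_op_compose[OF _ G] unfolding finite_rank_def by blast
  moreover have "inj (\<lambda>y. y + F (inv B y))"
    using inj_compose[OF inj bij_is_inj[OF bij_imp_bij_inv[OF bij]]] by (simp add: comp_def BG)
  ultimately have "surj (\<lambda>y. y + F (inv B y))" by (rule Fredholm_alternative)
  then have "\<exists>y. z = y + F (inv B y)" for z unfolding surj_def by blast
  then have "\<exists>x. z = B x + F x" for z by (metis BG)
  then show ?thesis unfolding surj_def by blast
qed

text \<open>If the sum vanishes, its two orthogonal summands vanish separately. Thus
  \<open>x\<close> lies in the null space of \<open>A\<close>, and injectivity of \<open>f\<close>
  lets each coefficient of \<open>x\<close> along \<open>e\<close> be read off as zero.\<close>

lemma inj_add_transfer:
  assumes A: "bounded_op A"
    and e: "orthonormal e" "span e = null_space A"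
    and g: "orthonormal g" "span g = null_space (adj A)"
    and f: "inj_on f e" "f ` e \<subseteq> g"
  shows "inj (\<lambda>x. A x + transfer e f x)"
proof -
  have T: "bounded_op (transfer e f)"
    using finite_rank_transfer e(1) by (simp add: finite_rank_def orthonormal_def)
  have "x = 0" if "A x + transfer e f x = 0" for x
  proof -
    have "transfer e f x \<in> perp (range A)"
      using transfer_in_span[OF f(2)] g(2) null_space_adj[OF A] by simp
    moreover have "transfer e f x = - A x" using that by (simp add: add_eq_0_iff)
    ultimately have "inner (A x) (A x) = 0" by (simp add: perp_def)
    then have Ax: "A x = 0" and Tx: "transfer e f x = 0"
      using \<open>transfer e f x = - A x\<close> by simp_all
    have "inner x u = 0" if "u \<in> e" for u
      using inner_transfer[OF g(1) _ f(2,1) that, of x] Tx e(1) by (simp add: orthonormal_def)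
    then have "transfer e id x = 0" by (simp add: transfer_def)
    then show ?thesis using transfer_id_span[OF e(1), of x] Ax e(2) by (simp add: null_space_def)
  qed
  then show ?thesis
    by (intro injI) (metis bounded_op_linear(3)[OF bounded_op_add[OF A T]] right_minus_eq)
qed

section \<open>Fredholm operators as isomorphism plus finite rank\<close>

lemma fredholm_imp_isomorphism_plus_finite_rank:
  assumes "fredholm A"
  shows "\<exists>B F. isomorphism B \<and> finite_rank F \<and> A = (\<lambda>x. B x + F x)"
proof -
  have A: "bounded_op A" and N: "fin_dim (null_space A)" and M: "fin_dim (null_space (adj A))"
    and deq: "dim (null_space A) = dim (null_space (adj A))" and cl: "closed (range A)"
    using assms by (auto simp: fredholm_def)
  obtain e where e: "orthonormal e" "span e = null_space A"
    using orthonormal_basis[OF N subspace_null_space[OF A]] .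
  obtain g where g: "orthonormal g" "span g = null_space (adj A)"
    using orthonormal_basis[OF M subspace_null_space[OF bounded_op_adj[OF A]]] .
  have fin: "finite e" "finite g" using e g by (auto simp: orthonormal_def)
  have "card e = card g" using dim_span_orthonormal e g deq by metis
  then obtain f where f: "bij_betw f e g" using finite_same_card_bij fin by blast
  then have f': "inj_on f e" "f ` e = g" by (auto simp: bij_betw_def)
  define T where "T = transfer e f"
  have fT: "finite_rank T" using finite_rank_transfer[OF fin(1)] by (simp add: T_def)
  have T: "bounded_op T" using fT by (simp add: finite_rank_def)
  define B where "B = (\<lambda>x. A x + T x)"
  have B: "bounded_op B" unfolding B_def by (rule bounded_op_add[OF A T])
  have inj: "inj B"
    unfolding B_def T_def using inj_add_transfer[OF A e g f'(1)] f'(2) by simp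
  have TA: "A (transfer e id x) = 0" for x
    using transfer_in_span[of id e e x] e(2) by (simp add: null_space_def)
  have "\<exists>x. y = B x" for y
  proof -
    \<comment> \<open>Closedness of the range is used here: \<open>A x0\<close> is the projection of
      \<open>y\<close> onto it, leaving a residual in the null space of the adjoint.\<close>
    obtain x0 where "\<forall>z\<in>range A. inner (y - A x0) z = 0"
      using orthogonal_projection[OF subspace_range[OF A] cl, of y] by auto
    then have "y - A x0 \<in> span g" unfolding g(2) null_space_adj[OF A] perp_def by blast
    define r where "r = y - A x0"
    have r: "r \<in> span g" using \<open>y - A x0 \<in> span g\<close> by (simp add: r_def)
    \<comment> \<open>Removing the null-space component of \<open>x0\<close> leaves its image under
      \<open>A\<close> unchanged and makes \<open>T\<close> vanish.\<close>
    define x1 where "x1 = x0 - transfer e id x0"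
    have Ax1: "A x1 = A x0" using TA by (simp add: x1_def bounded_op_linear(3)[OF A])
    have "inner x1 u = 0" if "u \<in> e" for u
      unfolding x1_def using orthonormal_residual[OF e(1)] that span_base by blast
    then have Tx1: "T x1 = 0" by (simp add: T_def transfer_def)
    \<comment> \<open>Copying the coefficients of \<open>r\<close> along \<open>g\<close> back to
      \<open>e\<close> gives an \<open>n\<close> with \<open>A n = 0\<close> and
      \<open>T n = r\<close>.\<close>
    define n where "n = (\<Sum>u\<in>e. scale (inner r (f u)) u)"
    have "n \<in> span e" unfolding n_def by (intro span_sum span_scale span_base)
    then have An: "A n = 0" using e(2) by (simp add: null_space_def)
    have "inner n u = inner r (f u)" if "u \<in> e" for u
    proof -
      have "inner n u = (\<Sum>v\<in>e. if v = u then inner r (f u) else 0)"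
        unfolding n_def inner_sum
        by (rule sum.cong[OF refl]) (use e(1) that in \<open>auto simp: inner_scale orthonormal_def\<close>)
      then show ?thesis using that fin by simp
    qed
    then have "T n = (\<Sum>u\<in>e. scale (inner r (f u)) (f u))" by (simp add: T_def transfer_def)
    also have "\<dots> = transfer g id r"
      unfolding transfer_def using sum.reindex_bij_betw[OF f, of "\<lambda>v. scale (inner r v) (id v)"]
      by simp
    also have "\<dots> = r" by (rule transfer_id_span[OF g(1) r])
    finally have "B (x1 + n) = y"
      unfolding bounded_op_linear(2)[OF B] by (simp add: B_def Ax1 Tx1 An r_def)
    then show ?thesis by metis
  qed
  then have "surj B" unfolding surj_def by blast
  then have "isomorphism B" using isomorphismI[OF B] inj by (simp add: bij_def)
  moreover have "A = (\<lambda>x. B x + - T x)" by (simp add: B_def)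
  ultimately show ?thesis using finite_rank_minus[OF fT] by blast
qed

section \<open>Isomorphism plus finite rank is Fredholm\<close>

lemma fin_dim_null_space:
  assumes B: "isomorphism B" and F: "finite_rank F"
  shows "fin_dim (null_space (\<lambda>x. B x + F x))"
proof (rule fin_dim_subset[of "inv B ` range F"])
  have bij: "bij B" and G: "bounded_op (inv B)" using B by (auto simp: isomorphism_def)
  have F': "bounded_op F" using F by (simp add: finite_rank_def)
  show "fin_dim (inv B ` range F)"
    using fin_dim_image[OF G] F by (simp add: finite_rank_def)
  show "null_space (\<lambda>x. B x + F x) \<subseteq> inv B ` range F"
  proof
    fix x assume "x \<in> null_space (\<lambda>x. B x + F x)"
    then have "B x = F (- x)"
      by (simp add: null_space_def bounded_op_linear[OF F'] eq_neg_iff_add_eq_0)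
    then have "x = inv B (F (- x))" using bij by (metis bij_is_inj inv_f_f)
    then show "x \<in> inv B ` range F" by blast
  qed
qed

text \<open>\<open>A + T\<close> is again an isomorphism plus a finite-rank operator, so its
  injectivity makes it onto. The bound \<open>le\<close> provides the injection \<open>f\<close>
  from which \<open>T\<close> is built.\<close>

lemma range_isomorphism_plus_finite_rank:
  assumes B: "isomorphism B" and F: "finite_rank F" and AB: "A = (\<lambda>x. B x + F x)"
    and e: "orthonormal e" "span e = null_space A"
    and g: "orthonormal g" "span g = null_space (adj A)"
    and le: "card e \<le> card g"
  shows "card e = card g" and "range A = perp (null_space (adj A))"
proof -
  have A: "bounded_op A"
    unfolding AB using B F by (auto simp: isomorphism_def finite_rank_def intro: bounded_op_add)
  have fin: "finite e" "finite g" using e g by (auto simp: orthonormal_def)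
  obtain f where f: "inj_on f e" "f ` e \<subseteq> g" using card_le_inj[OF fin le] by blast
  define T where "T = transfer e f"
  have fT: "finite_rank T" using finite_rank_transfer[OF fin(1)] by (simp add: T_def)
  have eq: "(\<lambda>x. A x + T x) = (\<lambda>x. B x + (F x + T x))" by (simp add: AB add.assoc)
  have "inj (\<lambda>x. A x + T x)" unfolding T_def by (rule inj_add_transfer[OF A e g f])
  then have "surj (\<lambda>x. A x + T x)"
    unfolding eq by (intro isomorphism_plus_finite_rank_surj B finite_rank_add F fT)
  then have surj: "\<exists>x. y = A x + T x" for y unfolding surj_def by blast
  have perp: "inner (A x) v = 0" if "v \<in> span g" for x v
    using that unfolding g(2) by (simp add: inner_adj[OF A] null_space_def)
  \<comment> \<open>A vector of \<open>g\<close> missed by \<open>f\<close> would be orthogonal to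
    the ranges of both \<open>A\<close> and \<open>T\<close>, hence to the whole space and to
    itself.\<close>
  have "v \<in> f ` e" if "v \<in> g" for v
  proof (rule ccontr)
    assume "v \<notin> f ` e"
    then have T0: "inner (T x) v = 0" for x
      unfolding T_def using inner_transfer_0[OF g(1) f(2)] that by blast
    obtain x where "v = A x + T x" using surj by blast
    then have "inner v v = inner (A x) v + inner (T x) v" by (metis inner_add)
    also have "\<dots> = 0" using perp[of v x] T0 that span_base by simp
    finally show False using that zero_notin_orthonormal[OF g(1)] by simp
  qed
  then have "f ` e = g" using f(2) by blast
  then show "card e = card g" using card_image[OF f(1)] by simp
  show "range A = perp (null_space (adj A))"
  proof (intro equalityI subsetI)
    fix y assume "y \<in> perp (null_space (adj A))"
    then have y: "inner y v = 0" if "v \<in> span g" for v using that g(2) by (simp add: perp_def)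
    obtain x where x: "y = A x + T x" using surj by blast
    have Ts: "T x \<in> span g" unfolding T_def by (rule transfer_in_span[OF f(2)])
    \<comment> \<open>Both \<open>y\<close> and \<open>A x\<close> are orthogonal to
      \<open>T x\<close>, so \<open>T x = 0\<close> and \<open>y = A x\<close>.\<close>
    have "inner (T x) (T x) = inner y (T x) - inner (A x) (T x)" by (simp add: x inner_add)
    also have "\<dots> = 0" using y perp Ts by simp
    finally show "y \<in> range A" using x by simp
  qed (use perp g(2) in \<open>auto simp: perp_def\<close>)
qed

lemma isomorphism_plus_finite_rank_imp_fredholm:
  assumes B: "isomorphism B" and F: "finite_rank F" and AB: "A = (\<lambda>x. B x + F x)"
  shows "fredholm A"
proof -
  have B': "bounded_op B" and F': "bounded_op F"
    using B F by (auto simp: isomorphism_def finite_rank_def)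
  have A: "bounded_op A" unfolding AB by (rule bounded_op_add[OF B' F'])
  note B2 = isomorphism_adj[OF B] and F2 = finite_rank_adj[OF F]
  have AB2: "adj A = (\<lambda>x. adj B x + adj F x)" unfolding AB by (rule adj_add[OF B' F'])
  have N: "fin_dim (null_space A)" unfolding AB by (rule fin_dim_null_space[OF B F])
  have M: "fin_dim (null_space (adj A))" unfolding AB2 by (rule fin_dim_null_space[OF B2 F2])
  obtain e where e: "orthonormal e" "span e = null_space A"
    using orthonormal_basis[OF N subspace_null_space[OF A]] .
  obtain g where g: "orthonormal g" "span g = null_space (adj A)"
    using orthonormal_basis[OF M subspace_null_space[OF bounded_op_adj[OF A]]] .
  \<comment> \<open>The double adjoint is \<open>A\<close>, so \<open>e\<close> serves as the second
    basis when the lemma is applied to \<open>adj A\<close>.\<close>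
  have e': "span e = null_space (adj (adj A))" using e(2) by (simp add: adj_adj[OF A])
  note R = range_isomorphism_plus_finite_rank[OF B F AB e g]
  note R2 = range_isomorphism_plus_finite_rank[OF B2 F2 AB2 g e(1) e']
  \<comment> \<open>Whichever basis is not the larger one, the lemma for \<open>A\<close> or for
    \<open>adj A\<close> gives equality. Both size hypotheses then hold, so each range is an
    orthogonal complement and hence closed.\<close>
  have card: "card e = card g" using R(1) R2(1) by (cases "card e \<le> card g") auto
  then have "closed (range A)" "closed (range (adj A))"
    using R(2) R2(2) closed_perp by simp_all
  moreover have "dim (null_space A) = dim (null_space (adj A))"
    using dim_span_orthonormal e g card by metis
  ultimately show ?thesis using A N M by (simp add: fredholm_def)
qed

end

theorem theorem1p2:
  fixes scale :: "'k::hilbert_scalar \<Rightarrow> 'v::banach \<Rightarrow> 'v"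
    and inner :: "'v \<Rightarrow> 'v \<Rightarrow> 'k"
    and A :: "'v \<Rightarrow> 'v"
  assumes "hilbert_space scale inner"
    and "hilbert_space.bounded_op scale A"
  shows "hilbert_space.fredholm scale inner A \<longleftrightarrow>
    (\<exists>B F. hilbert_space.isomorphism scale B \<and> hilbert_space.finite_rank scale F \<and>
           A = (\<lambda>x. B x + F x))"
proof -
  interpret hilbert_space scale inner by (rule assms(1))
  show ?thesis
    using fredholm_imp_isomorphism_plus_finite_rank isomorphism_plus_finite_rank_imp_fredholm
    by blast
qed

end
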